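(* Consider the proposed procedure $(\widetilde{\mathcal X},\widetilde T)$ with blocks $\Xi_1,\Xi_2$ and thresholds $b_2\ge b_1\ge1$, $d\ge1$. If $n\in\mathbb N$ is odd, let $B_n=\{\tau(S_n;d)<\sigma(S_n;b_2)\}$. Then for every odd $n\in\mathbb N$, on the event $\{S_n<\widetilde T\}$ we have $$\mathsf P(L_{S_n}=0\mid\mathcal F_{S_n})\le\frac1{1+b_1},\qquad\mathsf P(B_n,\,L_{S_n}=1\mid\mathcal F_{S_n})\le\frac1d\,\mathsf P(L_{S_n}=1\mid\mathcal F_{S_n}).$$
   Context: Setup. Fix $2\le K<\infty$, $[K]=\{1,\dots,K\}$, $\mathbb N=\{1,2,\dots\}$. There is a latent process $L_t\in\{0,1\}$, $t\ge0$, with $L_t=0$ for $t<\Theta$ and $L_t=1$ for $t\ge\Theta$ ($\Theta$ is the change-point). At each $t\in\mathbb N$ a treatment $X_t\in[K]$ is selected and a response $Y_t$ in a Polish space $\mathbb Y$ is observed; $\mathcal F_t=\sigma(X_s,Y_s:1\le s\le t)$, $\mathcal F_0$ trivial. An assignment rule $\mathcal X=\{X_t\}$ has $X_1$ deterministic and $X_t$ a measurable function of $X_1,\dots,X_{t-1},Y_1,\dots,Y_{t-1}$. Response model: for each $x\in[K]$, $f_x,g_x$ are densities with respect to a $\sigma$-finite measure $\mu$ on $\mathbb Y$; given $X_t=x,L_t=i,\mathcal F_{t-1},L_0,\dots,L_{t-1}$, $Y_t$ has density $f_x$ if $i=0$, $g_x$ if $i=1$. Change-point model: $\pi_0\in[0,1)$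 and functions $\pi_t:[K]^t\to[0,1)$ with $\mathsf P(L_0=1)=\pi_0$ and $\mathsf P(L_t=1\mid L_{t-1}=0,\mathcal F_{t-1},X_t)=\Pi_t:=\pi_t(X_1,\dots,X_t)$. Posterior odds: $\Gamma_t=\mathsf P(L_t=1|\mathcal F_t)/\mathsf P(L_t=0|\mathcal F_t)$; $\Lambda_t=g_{X_t}(Y_t)/f_{X_t}(Y_t)$. A block of length $\ell$ is $\Xi\in[K]^\ell$, extended cyclically by $\Xi(j\ell+i)=\Xi(i)$. Proposed procedure $(\widetilde{\mathcal X},\widetilde T)$. Let $\sigma(t;b)=\inf\{s\ge0:\Gamma_{t+s}\ge b\}$, $\tau(t;d)=\inf\{s\ge1:\prod_{j=1}^s\Lambda_{t+j}\le1/d\}$. Put $S_0=0$ and for $m\ge1$: $S_{2m-1}=S_{2m-2}+\sigma(S_{2m-2};b_1)$ and $S_{2m}=S_{2m-1}+\min\{\sigma(S_{2m-1};b_2),\tau(S_{2m-1};d)\}$. Treatments: $\widetilde X_t=\Xi_1(t-S_{2m-2})$ if $t\in(S_{2m-2},S_{2m-1}]$, $\widetilde X_t=\Xi_2(t-S_{2m-1})$ if $t\in(S_{2m-1},S_{2m}]$. Stopping: $\widetilde T=S_{2N}$, $N=\inf\{m\ge1:\sigma(S_{2m-1};b_2)\le\tau(S_{2m-1};d)\}$. *)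

theory Defs
  imports "HOL-Probability.Probability"
begin

section \<open>Latent process, history and conditional probabilities\<close>

text \<open>The change-point \<open>\<Theta>\<close> may be infinite (no change). Time is extended to \<^typ>\<open>enat\<close> so that the
  process can be evaluated at a random time; its value at \<open>\<infinity>\<close> plays no role.\<close>

definition latent :: "('a \<Rightarrow> enat) \<Rightarrow> enat \<Rightarrow> 'a \<Rightarrow> nat" where
  "latent \<Theta> t \<omega> = (if t < \<Theta> \<omega> then 0 else 1)"

text \<open>The history \<open>F\<^sub>t\<close> generated by \<open>X\<^sub>s, Y\<^sub>s\<close> for \<open>1 \<le> s \<le> t\<close>, with \<open>F\<^sub>\<infinity>\<close> generated by all of them. The
  index type \<^typ>\<open>enat\<close> makes the \<open>\<sigma>\<close>-algebra of a possibly infinite stopping time available as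
  \<^const>\<open>filtration.pre_sigma\<close>.\<close>

definition hist :: "'a measure \<Rightarrow> nat \<Rightarrow> (nat \<Rightarrow> 'a \<Rightarrow> nat) \<Rightarrow>
    (nat \<Rightarrow> 'a \<Rightarrow> 'y::topological_space) \<Rightarrow> enat \<Rightarrow> 'a measure" where
  "hist M K X Y t = sigma (space M)
     (\<Union>s\<in>{s. 1 \<le> s \<and> enat s \<le> t}.
        sets (vimage_algebra (space M) (X s) (count_space {1..K})) \<union>
        sets (vimage_algebra (space M) (Y s) borel))"

lemma filtration_hist: "filtration (space M) (hist M K X Y)"
proof -
  have gen: "(\<Union>s\<in>{s. 1 \<le> s \<and> enat s \<le> t}.
        sets (vimage_algebra (space M) (X s) (count_space {1..K})) \<union>
        sets (vimage_algebra (space M) (Y s) borel)) \<subseteq> Pow (space M)" for t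
    by (auto dest!: sets.sets_into_space simp: subset_iff)
  show ?thesis
  proof
    show "space (hist M K X Y i) = space M" for i
      unfolding hist_def using gen by (rule space_measure_of)
    show "sets (hist M K X Y i) \<subseteq> sets (hist M K X Y j)" if "i \<le> j" for i j
      unfolding hist_def sets_measure_of[OF gen]
      by (rule sigma_sets_mono') (use that order_trans in blast)
  qed
qed

definition stopped_hist :: "'a measure \<Rightarrow> nat \<Rightarrow> (nat \<Rightarrow> 'a \<Rightarrow> nat) \<Rightarrow>
    (nat \<Rightarrow> 'a \<Rightarrow> 'y::topological_space) \<Rightarrow> ('a \<Rightarrow> enat) \<Rightarrow> 'a measure" where
  "stopped_hist M K X Y R = filtration.pre_sigma (space M) (hist M K X Y) R"

definition cprob :: "'a measure \<Rightarrow> 'a measure \<Rightarrow> ('a \<Rightarrow> bool) \<Rightarrow> 'a \<Rightarrow> real" where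
  "cprob M G P = real_cond_exp M G (indicat_real {\<omega> \<in> space M. P \<omega>})"

section \<open>The change-point model\<close>

definition assignment_rule :: "'a measure \<Rightarrow> nat \<Rightarrow> (nat \<Rightarrow> 'a \<Rightarrow> nat) \<Rightarrow>
    (nat \<Rightarrow> 'a \<Rightarrow> 'y::topological_space) \<Rightarrow> bool" where
  "assignment_rule M K X Y \<longleftrightarrow>
     (\<exists>x\<in>{1..K}. \<forall>\<omega>\<in>space M. X 1 \<omega> = x) \<and>
     (\<forall>t\<ge>2. \<exists>\<phi> \<in> (Pi\<^sub>M {1..<t} (\<lambda>_. count_space {1..K}) \<Otimes>\<^sub>M Pi\<^sub>M {1..<t} (\<lambda>_. borel))
                  \<rightarrow>\<^sub>M count_space {1..K}.
        \<forall>\<omega>\<in>space M. X t \<omega> = \<phi> (\<lambda>s\<in>{1..<t}. X s \<omega>, \<lambda>s\<in>{1..<t}. Y s \<omega>))"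

text \<open>The functions \<open>\<pi>\<^sub>t\<close> on \<open>[K]\<^sup>t\<close> are given by one function on lists: \<open>\<pi>\<^sub>t\<close> is its restriction to the
  lists of length \<open>t\<close>, and \<open>\<pi>\<^sub>0\<close> is its value at the empty list. Conditioning on the event
  \<open>L\<^bsub>t-1\<^esub> = 0\<close> together with a \<open>\<sigma>\<close>-algebra means conditioning on the \<open>\<sigma>\<close>-algebra enlarged by
  \<open>L\<^bsub>t-1\<^esub>\<close> and evaluating on that event.\<close>

locale changepoint_model = prob_space M
  for M :: "'a measure" +
  fixes K :: nat
    and \<mu> :: "'y::polish_space measure"
    and f g :: "nat \<Rightarrow> 'y \<Rightarrow> real"
    and \<pi> :: "nat list \<Rightarrow> real"
    and \<Theta> :: "'a \<Rightarrow> enat"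
    and X :: "nat \<Rightarrow> 'a \<Rightarrow> nat"
    and Y :: "nat \<Rightarrow> 'a \<Rightarrow> 'y"
  assumes K_ge_2: "2 \<le> K"
    and sigma_finite_mu: "sigma_finite_measure \<mu>"
    and sets_mu: "sets \<mu> = sets borel"
    and density_f: "\<And>x. x \<in> {1..K} \<Longrightarrow>
      f x \<in> borel_measurable \<mu> \<and> (\<forall>y. 0 \<le> f x y) \<and> (\<integral>\<^sup>+ y. ennreal (f x y) \<partial>\<mu>) = 1"
    and density_g: "\<And>x. x \<in> {1..K} \<Longrightarrow>
      g x \<in> borel_measurable \<mu> \<and> (\<forall>y. 0 \<le> g x y) \<and> (\<integral>\<^sup>+ y. ennreal (g x y) \<partial>\<mu>) = 1"
    and pi_range: "\<And>xs. set xs \<subseteq> {1..K} \<Longrightarrow> 0 \<le> \<pi> xs \<and> \<pi> xs < 1"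
    and measurable_Theta: "\<Theta> \<in> M \<rightarrow>\<^sub>M count_space UNIV"
    and measurable_X: "\<And>t. 1 \<le> t \<Longrightarrow> X t \<in> M \<rightarrow>\<^sub>M count_space {1..K}"
    and measurable_Y: "\<And>t. 1 \<le> t \<Longrightarrow> Y t \<in> M \<rightarrow>\<^sub>M borel"
    and assignment: "assignment_rule M K X Y"
    and response: "\<And>t A. 1 \<le> t \<Longrightarrow> A \<in> sets borel \<Longrightarrow>
      AE \<omega> in M.
        cprob M (sigma (space M)
            (sets (hist M K X Y (enat (t - 1))) \<union>
             sets (vimage_algebra (space M) (X t) (count_space {1..K})) \<union>
             (\<Union>s\<in>{..t}. sets (vimage_algebra (space M) (latent \<Theta> (enat s)) (count_space UNIV)))))
          (\<lambda>\<omega>. Y t \<omega> \<in> A) \<omega>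
        = measure (density \<mu> (\<lambda>y. ennreal
            (if latent \<Theta> (enat t) \<omega> = 0 then f (X t \<omega>) y else g (X t \<omega>) y))) A"
    and initial_change: "measure M {\<omega> \<in> space M. latent \<Theta> 0 \<omega> = 1} = \<pi> []"
    and change: "\<And>t. 1 \<le> t \<Longrightarrow>
      AE \<omega> in M. latent \<Theta> (enat (t - 1)) \<omega> = 0 \<longrightarrow>
        cprob M (sigma (space M)
            (sets (hist M K X Y (enat (t - 1))) \<union>
             sets (vimage_algebra (space M) (X t) (count_space {1..K})) \<union>
             sets (vimage_algebra (space M) (latent \<Theta> (enat (t - 1))) (count_space UNIV))))
          (\<lambda>\<omega>. latent \<Theta> (enat t) \<omega> = 1) \<omega>
        = \<pi> (map (\<lambda>s. X s \<omega>) [1..<Suc t])"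

text \<open>Quotients are taken in \<^typ>\<open>ennreal\<close>, where a positive number divided by \<open>0\<close> is \<open>\<infinity>\<close>; for
  \<^typ>\<open>real\<close> it would be \<open>0\<close>. The value \<open>0 / 0\<close> occurs only on null sets.
  Conditional probabilities are determined only up to null sets, so \<open>\<Gamma>\<close> is an arbitrary version.\<close>

definition posterior_odds :: "'a measure \<Rightarrow> nat \<Rightarrow> ('a \<Rightarrow> enat) \<Rightarrow> (nat \<Rightarrow> 'a \<Rightarrow> nat) \<Rightarrow>
    (nat \<Rightarrow> 'a \<Rightarrow> 'y::topological_space) \<Rightarrow> (nat \<Rightarrow> 'a \<Rightarrow> ennreal) \<Rightarrow> bool" where
  "posterior_odds M K \<Theta> X Y \<Gamma> \<longleftrightarrow> (\<forall>t.
     \<Gamma> t \<in> borel_measurable (hist M K X Y (enat t)) \<and>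
     (AE \<omega> in M. \<Gamma> t \<omega> =
        ennreal (cprob M (hist M K X Y (enat t)) (\<lambda>\<omega>. latent \<Theta> (enat t) \<omega> = 1) \<omega>) /
        ennreal (cprob M (hist M K X Y (enat t)) (\<lambda>\<omega>. latent \<Theta> (enat t) \<omega> = 0) \<omega>)))"

definition lik_ratio :: "(nat \<Rightarrow> 'y \<Rightarrow> real) \<Rightarrow> (nat \<Rightarrow> 'y \<Rightarrow> real) \<Rightarrow> (nat \<Rightarrow> 'a \<Rightarrow> nat) \<Rightarrow>
    (nat \<Rightarrow> 'a \<Rightarrow> 'y) \<Rightarrow> nat \<Rightarrow> 'a \<Rightarrow> ennreal" where
  "lik_ratio f g X Y t \<omega> = ennreal (g (X t \<omega>) (Y t \<omega>)) / ennreal (f (X t \<omega>) (Y t \<omega>))"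

section \<open>The proposed procedure\<close>

definition block :: "nat \<Rightarrow> nat list \<Rightarrow> bool" where
  "block K \<Xi> \<longleftrightarrow> \<Xi> \<noteq> [] \<and> set \<Xi> \<subseteq> {1..K}"

text \<open>Cyclic extension of a block, with positions counted from \<open>1\<close>.\<close>

definition cyc :: "nat list \<Rightarrow> nat \<Rightarrow> nat" where
  "cyc \<Xi> i = \<Xi> ! ((i - 1) mod length \<Xi>)"

text \<open>The waiting times \<open>\<sigma>(t; b)\<close> and \<open>\<tau>(t; d)\<close>. The infimum of the empty set is \<open>\<infinity>\<close>, and both are \<open>\<infinity>\<close>
  when started at \<open>t = \<infinity>\<close>.\<close>

definition odds_time :: "(nat \<Rightarrow> 'a \<Rightarrow> ennreal) \<Rightarrow> real \<Rightarrow> enat \<Rightarrow> 'a \<Rightarrow> enat" where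
  "odds_time \<Gamma> b t \<omega> = (case t of
       enat u \<Rightarrow> (INF s\<in>{s. \<Gamma> (u + s) \<omega> \<ge> ennreal b}. enat s)
     | \<infinity> \<Rightarrow> \<infinity>)"

definition lr_time :: "(nat \<Rightarrow> 'a \<Rightarrow> ennreal) \<Rightarrow> real \<Rightarrow> enat \<Rightarrow> 'a \<Rightarrow> enat" where
  "lr_time \<Lambda> d t \<omega> = (case t of
       enat u \<Rightarrow> (INF s\<in>{s. 1 \<le> s \<and> (\<Prod>j=1..s. \<Lambda> (u + j) \<omega>) \<le> ennreal (1 / d)}. enat s)
     | \<infinity> \<Rightarrow> \<infinity>)"

text \<open>In the successor equation, an even \<open>n = 2m - 2\<close> gives \<open>S\<^bsub>2m-1\<^esub>\<close> and an odd \<open>n = 2m - 1\<close> gives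
  \<open>S\<^bsub>2m\<^esub>\<close>.\<close>

primrec stage :: "(nat \<Rightarrow> 'a \<Rightarrow> ennreal) \<Rightarrow> (nat \<Rightarrow> 'a \<Rightarrow> ennreal) \<Rightarrow> real \<Rightarrow> real \<Rightarrow> real \<Rightarrow>
    nat \<Rightarrow> 'a \<Rightarrow> enat" where
  "stage \<Gamma> \<Lambda> b\<^sub>1 b\<^sub>2 d 0 \<omega> = 0"
| "stage \<Gamma> \<Lambda> b\<^sub>1 b\<^sub>2 d (Suc n) \<omega> =
     (let S = stage \<Gamma> \<Lambda> b\<^sub>1 b\<^sub>2 d n \<omega> in
      if even n then S + odds_time \<Gamma> b\<^sub>1 S \<omega>
      else S + min (odds_time \<Gamma> b\<^sub>2 S \<omega>) (lr_time \<Lambda> d S \<omega>))"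

definition stop_cycle :: "(nat \<Rightarrow> 'a \<Rightarrow> ennreal) \<Rightarrow> (nat \<Rightarrow> 'a \<Rightarrow> ennreal) \<Rightarrow> real \<Rightarrow> real \<Rightarrow> real \<Rightarrow>
    'a \<Rightarrow> enat" where
  "stop_cycle \<Gamma> \<Lambda> b\<^sub>1 b\<^sub>2 d \<omega> =
     (INF m\<in>{m. 1 \<le> m \<and>
        odds_time \<Gamma> b\<^sub>2 (stage \<Gamma> \<Lambda> b\<^sub>1 b\<^sub>2 d (2 * m - 1) \<omega>) \<omega> \<le>
        lr_time \<Lambda> d (stage \<Gamma> \<Lambda> b\<^sub>1 b\<^sub>2 d (2 * m - 1) \<omega>) \<omega>}. enat m)"

definition stop_time :: "(nat \<Rightarrow> 'a \<Rightarrow> ennreal) \<Rightarrow> (nat \<Rightarrow> 'a \<Rightarrow> ennreal) \<Rightarrow> real \<Rightarrow> real \<Rightarrow> real \<Rightarrow>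
    'a \<Rightarrow> enat" where
  "stop_time \<Gamma> \<Lambda> b\<^sub>1 b\<^sub>2 d \<omega> = (case stop_cycle \<Gamma> \<Lambda> b\<^sub>1 b\<^sub>2 d \<omega> of
       enat m \<Rightarrow> stage \<Gamma> \<Lambda> b\<^sub>1 b\<^sub>2 d (2 * m) \<omega>
     | \<infinity> \<Rightarrow> \<infinity>)"

text \<open>The stages cover the times up to the stopping time; the treatments after it are left open.\<close>

definition proposed_treatments :: "'a measure \<Rightarrow> nat list \<Rightarrow> nat list \<Rightarrow> (nat \<Rightarrow> 'a \<Rightarrow> ennreal) \<Rightarrow>
    (nat \<Rightarrow> 'a \<Rightarrow> ennreal) \<Rightarrow> real \<Rightarrow> real \<Rightarrow> real \<Rightarrow> (nat \<Rightarrow> 'a \<Rightarrow> nat) \<Rightarrow> bool" where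
  "proposed_treatments M \<Xi>\<^sub>1 \<Xi>\<^sub>2 \<Gamma> \<Lambda> b\<^sub>1 b\<^sub>2 d X \<longleftrightarrow>
     (\<forall>\<omega>\<in>space M. \<forall>m\<ge>1. \<forall>t. let S = (\<lambda>n. stage \<Gamma> \<Lambda> b\<^sub>1 b\<^sub>2 d n \<omega>) in
        (enat t \<in> {S (2 * m - 2) <.. S (2 * m - 1)} \<longrightarrow>
           X t \<omega> = cyc \<Xi>\<^sub>1 (t - the_enat (S (2 * m - 2)))) \<and>
        (enat t \<in> {S (2 * m - 1) <.. S (2 * m)} \<longrightarrow>
           X t \<omega> = cyc \<Xi>\<^sub>2 (t - the_enat (S (2 * m - 1)))))"

end

theory Submission
  imports Defs
begin

text \<open>Both inequalities compare conditional probabilities given \<open>F\<^bsub>S\<^esub>\<close>, so it suffices to compare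
  probabilities on sets of \<open>F\<^bsub>S\<^esub>\<close> inside \<open>{S = u}\<close>, which belong to \<open>F\<^sub>u\<close>. At an odd stage the odds at \<open>u\<close> are at
  least \<open>b\<^sub>1\<close>, which is the first inequality. For the second, the reciprocal likelihood ratio products
  started at \<open>u\<close> form a nonnegative supermartingale with initial value \<open>1\<close> on \<open>{L\<^sub>u = 1}\<close>, whatever the
  assignment rule, and \<open>B\<^sub>n\<close> forces them to reach \<open>d\<close>: this has conditional probability at most \<open>1 / d\<close> by
  Ville's maximal inequality.\<close>

section \<open>Waiting times\<close>

lemma INF_enat_le_iff: "(INF s\<in>{s. P s}. enat s) \<le> enat k \<longleftrightarrow> (\<exists>s\<in>{..k}. P s)"
proof
  assume le: "(INF s\<in>{s. P s}. enat s) \<le> enat k"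
  then have "enat ` {s. P s} \<noteq> {}"
    by (metis Inf_enat_def enat_ile enat.distinct(1))
  then have "(INF s\<in>{s. P s}. enat s) \<in> enat ` {s. P s}"
    unfolding Inf_enat_def by (auto intro: LeastI)
  then show "\<exists>s\<in>{..k}. P s"
    using le by auto
next
  assume "\<exists>s\<in>{..k}. P s"
  then show "(INF s\<in>{s. P s}. enat s) \<le> enat k"
    by (auto intro!: INF_lower2)
qed

lemma INF_enat_eqD:
  assumes "(INF s\<in>{s. P s}. enat s) = enat k"
  shows "P k"
proof -
  obtain s where s: "s \<le> k" "P s"
    using INF_enat_le_iff[of P k] assms by auto
  have "enat k \<le> enat s"
    unfolding assms[symmetric] using s by (intro INF_lower) simp
  with s show ?thesis
    by simp
qed

lemma odds_time_le_iff:
  "odds_time \<Gamma> b (enat u) \<omega> \<le> enat k \<longleftrightarrow> (\<exists>s\<in>{..k}. ennreal b \<le> \<Gamma> (u + s) \<omega>)"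
  unfolding odds_time_def enat.case by (rule INF_enat_le_iff)

lemma odds_time_eqD: "odds_time \<Gamma> b (enat u) \<omega> = enat k \<Longrightarrow> ennreal b \<le> \<Gamma> (u + k) \<omega>"
  unfolding odds_time_def enat.case by (rule INF_enat_eqD)

lemma lr_time_le_iff:
  "lr_time \<Lambda> d (enat u) \<omega> \<le> enat k \<longleftrightarrow>
     (\<exists>s\<in>{..k}. 1 \<le> s \<and> (\<Prod>j=1..s. \<Lambda> (u + j) \<omega>) \<le> ennreal (1 / d))"
  unfolding lr_time_def enat.case by (rule INF_enat_le_iff)

lemma stage_odd_odds:
  assumes "odd n" "stage \<Gamma> \<Lambda> b\<^sub>1 b\<^sub>2 d n \<omega> = enat u"
  shows "ennreal b\<^sub>1 \<le> \<Gamma> u \<omega>"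
proof -
  obtain m where m: "n = Suc m" "even m"
    using assms(1) by (cases n) auto
  let ?S = "stage \<Gamma> \<Lambda> b\<^sub>1 b\<^sub>2 d m \<omega>"
  have sum: "?S + odds_time \<Gamma> b\<^sub>1 ?S \<omega> = enat u"
    using assms(2) m by (simp add: Let_def)
  then obtain v k where v: "?S = enat v" "odds_time \<Gamma> b\<^sub>1 ?S \<omega> = enat k"
    by (cases ?S; cases "odds_time \<Gamma> b\<^sub>1 ?S \<omega>") auto
  then have "u = v + k"
    using sum by simp
  then show ?thesis
    using odds_time_eqD[of \<Gamma> b\<^sub>1 v \<omega> k] v by simp
qed

lemma measurable_enat_le:
  assumes "\<And>k. Measurable.pred N (\<lambda>\<omega>. T \<omega> \<le> enat k)"
  shows "T \<in> N \<rightarrow>\<^sub>M count_space (UNIV :: enat set)"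
proof -
  have "Measurable.pred N (\<lambda>\<omega>. T \<omega> \<le> t)" for t
    using assms by (cases t) auto
  then have "T \<in> borel_measurable N"
    by (intro borel_measurableI_le) (simp add: pred_def)
  moreover have "measurable N (borel :: enat measure) = measurable N (count_space UNIV)"
    by (intro measurable_cong_sets refl) (rule sets_borel_eq_count_space)
  ultimately show ?thesis
    by simp
qed

section \<open>Extended nonnegative reals\<close>

lemma le_divide_ennreal_imp_mult_le:
  fixes p q b :: real
  assumes "ennreal b \<le> ennreal q / ennreal p" "0 \<le> p" "0 \<le> q" "0 \<le> b"
  shows "b * p \<le> q"
proof (cases "p = 0")
  case False
  then have "ennreal b \<le> ennreal (q / p)"
    using assms by (simp add: divide_ennreal)
  then have "b \<le> q / p"
    using assms by (simp add: ennreal_le_iff)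
  then show ?thesis
    using assms False by (simp add: field_simps)
qed (use assms in simp)

lemma inverse_antimono_ennreal: "a \<le> b \<Longrightarrow> inverse b \<le> inverse (a :: ennreal)"
  including ennreal.lifting
  by transfer (rule ereal_inverse_antimono)

lemma inverse_prod_ennreal:
  fixes F :: "'i \<Rightarrow> ennreal"
  assumes "\<And>j. j \<in> J \<Longrightarrow> F j \<noteq> 0"
  shows "inverse (\<Prod>j\<in>J. F j) = (\<Prod>j\<in>J. inverse (F j))"
  using assms
proof (induction J rule: infinite_finite_induct)
  case (insert x J)
  then have "F x \<noteq> 0" "(\<Prod>j\<in>J. F j) \<noteq> 0"
    by auto
  then show ?case
    using insert by (simp add: ennreal_inverse_mult' zero_less_iff_neq_zero)
qed auto

lemma inverse_ratio_times_le:
  fixes p q :: real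
  assumes "0 \<le> p" "0 \<le> q"
  shows "inverse (ennreal q / ennreal p) * ennreal q \<le> ennreal p"
proof (cases "q = 0")
  case False
  then have q: "0 < q"
    using assms by simp
  show ?thesis
  proof (cases "p = 0")
    case True
    then show ?thesis
      using q by (simp add: divide_ennreal_def ennreal_mult_top)
  next
    case False
    then have p: "0 < p"
      using assms by simp
    then have "inverse (ennreal q / ennreal p) * ennreal q = ennreal (inverse (q / p) * q)"
      using q by (simp add: divide_ennreal inverse_ennreal ennreal_mult[symmetric])
    also have "inverse (q / p) * q = p"
      using p q by simp
    finally show ?thesis
      by simp
  qed
qed simp

section \<open>Comparison of conditional probabilities\<close>

context prob_space
begin

lemma set_integral_cprob:
  assumes "subalgebra M G" and P: "{\<omega> \<in> space M. P \<omega>} \<in> events" and "A \<in> sets G"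
  shows "set_integrable M A (cprob M G P)"
    and "(LINT \<omega>:A|M. cprob M G P \<omega>) = prob {\<omega> \<in> A. P \<omega>}"
proof -
  interpret finite_measure_subalgebra M G
    by standard fact
  have A: "A \<in> events"
    using assms unfolding subalgebra_def by auto
  have int: "integrable M (indicat_real {\<omega> \<in> space M. P \<omega>})"
    using P by (intro integrable_real_indicator) (auto simp: emeasure_eq_measure)
  show "set_integrable M A (cprob M G P)"
    unfolding set_integrable_def cprob_def
    using integrable_mult_indicator[OF A real_cond_exp_int(1)[OF int]] .
  have "(LINT \<omega>:A|M. cprob M G P \<omega>) = (LINT \<omega>:A|M. indicat_real {\<omega> \<in> space M. P \<omega>} \<omega>)"
    unfolding cprob_def using real_cond_exp_intA[OF int \<open>A \<in> sets G\<close>] by simp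
  also have "\<dots> = (LINT \<omega>|M. indicat_real {\<omega> \<in> A. P \<omega>} \<omega>)"
    unfolding set_lebesgue_integral_def
    by (intro Bochner_Integration.integral_cong) (auto simp: indicator_def)
  also have "\<dots> = prob {\<omega> \<in> A. P \<omega>}"
  proof -
    have "{\<omega> \<in> A. P \<omega>} = A \<inter> {\<omega> \<in> space M. P \<omega>}"
      using sets.sets_into_space[OF A] by auto
    then have "{\<omega> \<in> A. P \<omega>} \<in> events"
      using A P by simp
    then show ?thesis
      by (simp add: Int_absorb2 sets.sets_into_space)
  qed
  finally show "(LINT \<omega>:A|M. cprob M G P \<omega>) = prob {\<omega> \<in> A. P \<omega>}" .
qed

lemma AE_cprob_nonneg:
  assumes "subalgebra M G" and P: "{\<omega> \<in> space M. P \<omega>} \<in> events"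
  shows "AE \<omega> in M. 0 \<le> cprob M G P \<omega>"
proof -
  interpret finite_measure_subalgebra M G
    by standard fact
  show ?thesis
    unfolding cprob_def using P by (intro real_cond_exp_pos) auto
qed

lemma AE_cprob_le:
  assumes sub: "subalgebra M G"
    and P: "{\<omega> \<in> space M. P \<omega>} \<in> events" and Q: "{\<omega> \<in> space M. Q \<omega>} \<in> events"
    and C: "C \<in> sets G"
    and le: "\<And>A. A \<in> sets G \<Longrightarrow> A \<subseteq> C \<Longrightarrow> prob {\<omega> \<in> A. P \<omega>} \<le> c * prob {\<omega> \<in> A. Q \<omega>}"
  shows "AE \<omega> in M. \<omega> \<in> C \<longrightarrow> cprob M G P \<omega> \<le> c * cprob M G Q \<omega>"
proof -
  let ?D = "\<lambda>\<omega>. cprob M G P \<omega> - c * cprob M G Q \<omega>"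
  define A where "A = {\<omega> \<in> C. 0 < ?D \<omega>}"
  have meas: "cprob M G P \<in> borel_measurable G" "cprob M G Q \<in> borel_measurable G"
    by (simp_all add: cprob_def)
  have "A = C \<inter> {\<omega> \<in> space G. 0 < ?D \<omega>}"
    using sets.sets_into_space[OF C] by (auto simp: A_def)
  also have "\<dots> \<in> sets G"
    using C meas by measurable
  finally have A: "A \<in> sets G" .
  note intP = set_integral_cprob[OF sub P A] and intQ = set_integral_cprob[OF sub Q A]
  have int: "set_integrable M A ?D"
    using intP(1) intQ(1) by (intro set_integral_diff set_integrable_mult_right)
  have "(LINT \<omega>:A|M. ?D \<omega>) = prob {\<omega> \<in> A. P \<omega>} - c * prob {\<omega> \<in> A. Q \<omega>}"
    using intP intQ by (simp add: set_integral_diff set_integrable_mult_right)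
  also have "\<dots> \<le> 0"
    using le[OF A] by (auto simp: A_def)
  finally have le0: "(LINT \<omega>:A|M. ?D \<omega>) \<le> 0" .
  have nonneg: "0 \<le> indicat_real A \<omega> * ?D \<omega>" for \<omega>
    by (auto simp: indicator_def A_def)
  have "(LINT \<omega>|M. indicat_real A \<omega> * ?D \<omega>) = 0"
    using le0 nonneg unfolding set_lebesgue_integral_def
    by (intro antisym integral_nonneg) auto
  then have "AE \<omega> in M. indicat_real A \<omega> * ?D \<omega> = 0"
    using int nonneg unfolding set_integrable_def
    by (subst integral_nonneg_eq_0_iff_AE[symmetric]) auto
  then show ?thesis
    by eventually_elim (auto simp: A_def indicator_def not_less)
qed

lemma nn_integral_cprob:
  assumes sub: "subalgebra M G" and P: "{\<omega> \<in> space M. P \<omega>} \<in> events"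
    and Z: "Z \<in> borel_measurable G"
  shows "(\<integral>\<^sup>+\<omega>. Z \<omega> * ennreal (cprob M G P \<omega>) \<partial>M) = (\<integral>\<^sup>+\<omega>. Z \<omega> * indicator {\<omega> \<in> space M. P \<omega>} \<omega> \<partial>M)"
proof -
  interpret finite_measure_subalgebra M G
    by standard fact
  let ?I = "indicator {\<omega> \<in> space M. P \<omega>} :: 'a \<Rightarrow> ennreal"
  have [measurable]: "?I \<in> borel_measurable M"
    using P by simp
  have "(\<integral>\<^sup>+\<omega>. nn_cond_exp M G ?I \<omega> \<partial>M) = (\<integral>\<^sup>+\<omega>. ?I \<omega> \<partial>M)"
    using nn_cond_exp_intg[of "\<lambda>_. 1" ?I] by simp
  also have "\<dots> \<noteq> \<infinity>"
    using P by (simp add: emeasure_eq_measure)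
  finally have fin: "AE \<omega> in M. nn_cond_exp M G ?I \<omega> \<noteq> \<infinity>"
    by (intro nn_integral_PInf_AE) auto
  have zero: "AE \<omega> in M. 0 = nn_cond_exp M G (\<lambda>_. 0) \<omega>"
    by (intro nn_cond_exp_F_meas) simp
  have eq: "(\<lambda>x. ennreal (indicat_real {\<omega> \<in> space M. P \<omega>} x)) = ?I"
    "(\<lambda>x. ennreal (- indicat_real {\<omega> \<in> space M. P \<omega>} x)) = (\<lambda>_. 0)"
    by (auto simp: indicator_def ennreal_neg)
  have "AE \<omega> in M. ennreal (cprob M G P \<omega>) = nn_cond_exp M G ?I \<omega>"
    using fin zero
    by eventually_elim (simp add: cprob_def real_cond_exp_def eq less_top)
  then have "(\<integral>\<^sup>+\<omega>. Z \<omega> * ennreal (cprob M G P \<omega>) \<partial>M) = (\<integral>\<^sup>+\<omega>. Z \<omega> * nn_cond_exp M G ?I \<omega> \<partial>M)"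
    by (intro nn_integral_cong_AE) auto
  also have "\<dots> = (\<integral>\<^sup>+\<omega>. Z \<omega> * ?I \<omega> \<partial>M)"
    using Z by (intro nn_cond_exp_intg) auto
  finally show ?thesis .
qed

end

section \<open>Ville's inequality\<close>

lemma maximal_inequality:
  fixes W :: "nat \<Rightarrow> 'a \<Rightarrow> ennreal" and d :: ennreal
  assumes E [measurable]: "E \<in> sets M" and W [measurable]: "\<And>s. W s \<in> borel_measurable M"
    and super: "\<And>s. (\<integral>\<^sup>+\<omega>. indicator {\<omega> \<in> E. \<forall>i\<in>{1..s}. W i \<omega> < d} \<omega> * W (Suc s) \<omega> \<partial>M) \<le>
      (\<integral>\<^sup>+\<omega>. indicator {\<omega> \<in> E. \<forall>i\<in>{1..s}. W i \<omega> < d} \<omega> * W s \<omega> \<partial>M)"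
  shows "d * emeasure M {\<omega> \<in> E. \<exists>i\<ge>1. d \<le> W i \<omega>} \<le> (\<integral>\<^sup>+\<omega>. indicator E \<omega> * W 0 \<omega> \<partial>M)"
proof -
  define hit where "hit s \<omega> \<longleftrightarrow> (\<exists>i\<in>{1..s}. d \<le> W i \<omega>)" for s \<omega>
  have hit_Suc: "hit (Suc s) \<omega> \<longleftrightarrow> hit s \<omega> \<or> d \<le> W (Suc s) \<omega>" for s \<omega>
    unfolding hit_def by (simp add: atLeastAtMostSuc_conv disj_commute)
  have [measurable]: "Measurable.pred M (hit s)" for s
    unfolding hit_def by measurable
  have EM: "E \<subseteq> space M"
    using E by (rule sets.sets_into_space)
  have sets [measurable]: "{\<omega> \<in> E. hit s \<omega>} \<in> sets M" "{\<omega> \<in> E. \<not> hit s \<omega>} \<in> sets M" for s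
  proof -
    have "{\<omega> \<in> E. hit s \<omega>} = E \<inter> {\<omega> \<in> space M. hit s \<omega>}" "{\<omega> \<in> E. \<not> hit s \<omega>} = E \<inter> {\<omega> \<in> space M. \<not> hit s \<omega>}"
      using EM by auto
    then show "{\<omega> \<in> E. hit s \<omega>} \<in> sets M" "{\<omega> \<in> E. \<not> hit s \<omega>} \<in> sets M"
      by simp_all
  qed
  have not_hit: "{\<omega> \<in> E. \<forall>i\<in>{1..s}. W i \<omega> < d} = {\<omega> \<in> E. \<not> hit s \<omega>}" for s
    by (auto simp: hit_def not_le)
  define V where "V s \<omega> = indicator {\<omega> \<in> E. hit s \<omega>} \<omega> * d + indicator {\<omega> \<in> E. \<not> hit s \<omega>} \<omega> * W s \<omega>" for s \<omega>
  have int_V: "(\<integral>\<^sup>+\<omega>. V s \<omega> \<partial>M) \<le> (\<integral>\<^sup>+\<omega>. indicator E \<omega> * W 0 \<omega> \<partial>M)" for s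
  proof (induction s)
    case 0
    show ?case
      by (intro nn_integral_mono) (auto simp: V_def hit_def indicator_def)
  next
    case (Suc s)
    have "(\<integral>\<^sup>+\<omega>. V (Suc s) \<omega> \<partial>M) \<le>
        (\<integral>\<^sup>+\<omega>. indicator {\<omega> \<in> E. hit s \<omega>} \<omega> * d + indicator {\<omega> \<in> E. \<not> hit s \<omega>} \<omega> * W (Suc s) \<omega> \<partial>M)"
      by (intro nn_integral_mono) (auto simp: V_def hit_Suc indicator_def)
    also have "\<dots> = (\<integral>\<^sup>+\<omega>. indicator {\<omega> \<in> E. hit s \<omega>} \<omega> * d \<partial>M) +
        (\<integral>\<^sup>+\<omega>. indicator {\<omega> \<in> E. \<not> hit s \<omega>} \<omega> * W (Suc s) \<omega> \<partial>M)"
      by (rule nn_integral_add) measurable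
    also have "\<dots> \<le> (\<integral>\<^sup>+\<omega>. indicator {\<omega> \<in> E. hit s \<omega>} \<omega> * d \<partial>M) +
        (\<integral>\<^sup>+\<omega>. indicator {\<omega> \<in> E. \<not> hit s \<omega>} \<omega> * W s \<omega> \<partial>M)"
      using super[of s] unfolding not_hit by (intro add_left_mono)
    also have "\<dots> = (\<integral>\<^sup>+\<omega>. V s \<omega> \<partial>M)"
      unfolding V_def by (rule nn_integral_add[symmetric]) measurable
    finally show ?case
      using Suc by (rule order_trans)
  qed
  have bound: "d * emeasure M {\<omega> \<in> E. hit s \<omega>} \<le> (\<integral>\<^sup>+\<omega>. indicator E \<omega> * W 0 \<omega> \<partial>M)" for s
  proof -
    have "d * emeasure M {\<omega> \<in> E. hit s \<omega>} = (\<integral>\<^sup>+\<omega>. d * indicator {\<omega> \<in> E. hit s \<omega>} \<omega> \<partial>M)"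
      by (rule nn_integral_cmult_indicator[symmetric]) measurable
    also have "\<dots> \<le> (\<integral>\<^sup>+\<omega>. V s \<omega> \<partial>M)"
      by (intro nn_integral_mono) (auto simp: V_def mult.commute)
    finally show ?thesis
      using int_V by (rule order_trans)
  qed
  have "{\<omega> \<in> E. \<exists>i\<ge>1. d \<le> W i \<omega>} = (\<Union>s. {\<omega> \<in> E. hit s \<omega>})"
    by (auto simp: hit_def) (metis atLeastAtMost_iff One_nat_def order_refl)
  moreover have "incseq (\<lambda>s. {\<omega> \<in> E. hit s \<omega>})"
    by (intro incseq_SucI) (auto simp: hit_Suc)
  ultimately have "emeasure M {\<omega> \<in> E. \<exists>i\<ge>1. d \<le> W i \<omega>} = (SUP s. emeasure M {\<omega> \<in> E. hit s \<omega>})"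
    using SUP_emeasure_incseq[of "\<lambda>s. {\<omega> \<in> E. hit s \<omega>}" M] sets(1) by (simp add: image_subset_iff)
  then show ?thesis
    using bound by (simp add: SUP_mult_left_ennreal SUP_least)
qed

section \<open>Responses after the change\<close>

context changepoint_model
begin

abbreviation \<F> :: "enat \<Rightarrow> 'a measure" where
  "\<F> \<equiv> hist M K X Y"

definition pre_response :: "nat \<Rightarrow> 'a measure" where
  "pre_response t = sigma (space M)
     (sets (\<F> (enat (t - 1))) \<union>
      sets (vimage_algebra (space M) (X t) (count_space {1..K})) \<union>
      (\<Union>s\<in>{..t}. sets (vimage_algebra (space M) (latent \<Theta> (enat s)) (count_space UNIV))))"

interpretation filt: filtration "space M" \<F>
  by (rule filtration_hist)

lemma sets_hist:
  "sets (\<F> t) = sigma_sets (space M) (\<Union>s\<in>{s. 1 \<le> s \<and> enat s \<le> t}.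
     sets (vimage_algebra (space M) (X s) (count_space {1..K})) \<union>
     sets (vimage_algebra (space M) (Y s) borel))"
  unfolding hist_def by (rule sets_measure_of) (auto dest!: sets.sets_into_space simp: subset_iff)

lemma subalgebra_hist: "subalgebra M (\<F> t)"
  unfolding subalgebra_def
proof
  show "sets (\<F> t) \<subseteq> sets M"
    unfolding sets_hist
    by (intro sets.sigma_sets_subset UN_least Un_least sets_image_in_sets)
      (use measurable_X measurable_Y in simp_all)
qed (rule filt.space_F)

lemma measurable_vimage_generated:
  assumes "sets (vimage_algebra (space M) h N) \<subseteq> sets G" "space G = space M" "h \<in> M \<rightarrow>\<^sub>M N"
  shows "h \<in> G \<rightarrow>\<^sub>M N"
proof (rule measurableI)
  show "h x \<in> space N" if "x \<in> space G" for x
    using that assms by (simp add: measurable_space)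
  show "h -` A \<inter> space G \<in> sets G" if "A \<in> sets N" for A
    using in_vimage_algebra[OF that, of h "space M"] assms by auto
qed

lemma measurable_X_hist:
  assumes "1 \<le> s" "enat s \<le> t"
  shows "X s \<in> \<F> t \<rightarrow>\<^sub>M count_space {1..K}"
proof (rule measurable_vimage_generated)
  show "sets (vimage_algebra (space M) (X s) (count_space {1..K})) \<subseteq> sets (\<F> t)"
    unfolding sets_hist using assms by (intro subsetI sigma_sets.Basic) auto
qed (use assms measurable_X in \<open>simp_all add: filt.space_F\<close>)

lemma measurable_Y_hist:
  assumes "1 \<le> s" "enat s \<le> t"
  shows "Y s \<in> \<F> t \<rightarrow>\<^sub>M borel"
proof (rule measurable_vimage_generated)
  show "sets (vimage_algebra (space M) (Y s) borel) \<subseteq> sets (\<F> t)"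
    unfolding sets_hist using assms by (intro subsetI sigma_sets.Basic) auto
qed (use assms measurable_Y in \<open>simp_all add: filt.space_F\<close>)

lemma measurable_density:
  assumes "x \<in> {1..K}"
  shows "f x \<in> borel_measurable borel" "g x \<in> borel_measurable borel"
  using density_f[OF assms] density_g[OF assms]
  unfolding measurable_cong_sets[OF sets_mu refl] by blast+

lemma measurable_lik_ratio_hist:
  assumes "1 \<le> s" "enat s \<le> t"
  shows "lik_ratio f g X Y s \<in> borel_measurable (\<F> t)"
proof -
  have comp: "(\<lambda>\<omega>. h (X s \<omega>) (Y s \<omega>)) \<in> borel_measurable (\<F> t)"
    if "\<And>x. x \<in> {1..K} \<Longrightarrow> h x \<in> borel_measurable borel" for h :: "nat \<Rightarrow> 'y \<Rightarrow> real"
    by (rule measurable_compose_countable'[OF measurable_compose[OF measurable_Y_hist[OF assms] that]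
          measurable_X_hist[OF assms]]) auto
  have [measurable]: "(\<lambda>\<omega>. f (X s \<omega>) (Y s \<omega>)) \<in> borel_measurable (\<F> t)"
    "(\<lambda>\<omega>. g (X s \<omega>) (Y s \<omega>)) \<in> borel_measurable (\<F> t)"
    by (rule comp[OF measurable_density(1)], simp, rule comp[OF measurable_density(2)], simp)
  show ?thesis
    unfolding lik_ratio_def by measurable
qed

lemma measurable_latent: "latent \<Theta> t \<in> M \<rightarrow>\<^sub>M count_space UNIV"
proof -
  note [measurable] = measurable_Theta
  show ?thesis
    unfolding latent_def by measurable
qed

lemma sets_pre_response:
  "sets (pre_response t) = sigma_sets (space M)
     (sets (\<F> (enat (t - 1))) \<union>
      sets (vimage_algebra (space M) (X t) (count_space {1..K})) \<union>
      (\<Union>s\<in>{..t}. sets (vimage_algebra (space M) (latent \<Theta> (enat s)) (count_space UNIV))))"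
  and space_pre_response: "space (pre_response t) = space M"
proof -
  have vimage: "sets (vimage_algebra (space M) h N) \<subseteq> Pow (space M)" for h :: "'a \<Rightarrow> nat" and N
    using sets.space_closed[of "vimage_algebra (space M) h N"] by simp
  have gen: "sets (\<F> (enat (t - 1))) \<union>
      sets (vimage_algebra (space M) (X t) (count_space {1..K})) \<union>
      (\<Union>s\<in>{..t}. sets (vimage_algebra (space M) (latent \<Theta> (enat s)) (count_space UNIV)))
      \<subseteq> Pow (space M)"
    using sets.space_closed[of "\<F> (enat (t - 1))"]
    by (intro Un_least UN_least vimage) (simp add: filt.space_F)
  show "sets (pre_response t) = sigma_sets (space M)
     (sets (\<F> (enat (t - 1))) \<union>
      sets (vimage_algebra (space M) (X t) (count_space {1..K})) \<union>
      (\<Union>s\<in>{..t}. sets (vimage_algebra (space M) (latent \<Theta> (enat s)) (count_space UNIV))))"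
    unfolding pre_response_def by (rule sets_measure_of[OF gen])
  show "space (pre_response t) = space M"
    unfolding pre_response_def by (rule space_measure_of[OF gen])
qed

lemma subalgebra_pre_response:
  assumes "1 \<le> t"
  shows "subalgebra M (pre_response t)"
  unfolding subalgebra_def
proof
  have "sets (\<F> (enat (t - 1))) \<subseteq> sets M"
    using subalgebra_hist unfolding subalgebra_def by blast
  then show "sets (pre_response t) \<subseteq> sets M"
    unfolding sets_pre_response using assms
    by (intro sets.sigma_sets_subset UN_least Un_least sets_image_in_sets)
      (use assms measurable_X measurable_latent in simp_all)
qed (rule space_pre_response)

lemma hist_subset_pre_response:
  assumes "u < t"
  shows "sets (\<F> (enat u)) \<subseteq> sets (pre_response t)"
proof -
  have "sets (\<F> (enat u)) \<subseteq> sets (\<F> (enat (t - 1)))"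
    using assms by (intro filt.sets_F_mono) simp
  then show ?thesis
    unfolding sets_pre_response by (intro subsetI sigma_sets.Basic) blast
qed

lemma measurable_hist_pre_response:
  "u < t \<Longrightarrow> h \<in> \<F> (enat u) \<rightarrow>\<^sub>M N \<Longrightarrow> h \<in> pre_response t \<rightarrow>\<^sub>M N"
  by (rule measurable_from_subalg)
    (auto simp: subalgebra_def filt.space_F space_pre_response hist_subset_pre_response)

lemma measurable_X_pre_response:
  assumes "1 \<le> t"
  shows "X t \<in> pre_response t \<rightarrow>\<^sub>M count_space {1..K}"
proof (rule measurable_vimage_generated)
  show "sets (vimage_algebra (space M) (X t) (count_space {1..K})) \<subseteq> sets (pre_response t)"
    unfolding sets_pre_response by (intro subsetI sigma_sets.Basic) auto
qed (use assms measurable_X in \<open>simp_all add: space_pre_response\<close>)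

lemma measurable_latent_pre_response:
  assumes "s \<le> t"
  shows "latent \<Theta> (enat s) \<in> pre_response t \<rightarrow>\<^sub>M count_space UNIV"
proof (rule measurable_vimage_generated)
  show "sets (vimage_algebra (space M) (latent \<Theta> (enat s)) (count_space UNIV)) \<subseteq> sets (pre_response t)"
    unfolding sets_pre_response using assms by (intro subsetI sigma_sets.Basic) auto
qed (simp_all add: space_pre_response measurable_latent)

lemma nn_integral_response:
  fixes h :: "'y \<Rightarrow> ennreal"
  assumes t: "1 \<le> t" and u: "u \<le> t" and x: "x \<in> {1..K}"
    and Z: "Z \<in> borel_measurable (pre_response t)" and h: "h \<in> borel_measurable borel"
  shows "(\<integral>\<^sup>+\<omega>. Z \<omega> * indicator {\<omega> \<in> space M. latent \<Theta> (enat u) \<omega> = 1 \<and> X t \<omega> = x} \<omega> * h (Y t \<omega>) \<partial>M) =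
    (\<integral>\<^sup>+\<omega>. Z \<omega> * indicator {\<omega> \<in> space M. latent \<Theta> (enat u) \<omega> = 1 \<and> X t \<omega> = x} \<omega> \<partial>M) *
      (\<integral>\<^sup>+y. h y * ennreal (g x y) \<partial>\<mu>)"
proof -
  define E where "E = {\<omega> \<in> space M. latent \<Theta> (enat u) \<omega> = 1 \<and> X t \<omega> = x}"
  define V where "V \<omega> = Z \<omega> * indicator E \<omega>" for \<omega>
  define \<nu> where "\<nu> = distr (density M V) borel (Y t)"
  define \<rho> where "\<rho> = scale_measure (\<integral>\<^sup>+\<omega>. V \<omega> \<partial>M) (density \<mu> (\<lambda>y. ennreal (g x y)))"
  note [measurable] = measurable_X_pre_response[OF t] measurable_latent_pre_response[OF u] Z
    measurable_Y[OF t]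
  have "{\<omega> \<in> space (pre_response t). latent \<Theta> (enat u) \<omega> = 1 \<and> X t \<omega> = x} \<in> sets (pre_response t)"
    by measurable
  then have E: "E \<in> sets (pre_response t)"
    by (simp add: E_def space_pre_response)
  then have V: "V \<in> borel_measurable (pre_response t)"
    unfolding V_def by measurable
  then have VM [measurable]: "V \<in> borel_measurable M"
    using subalgebra_pre_response[OF t] by (rule measurable_from_subalg[rotated])
  have gm: "(\<lambda>y. ennreal (g x y)) \<in> borel_measurable \<mu>"
    using density_g[OF x] by simp
  have hmu: "h \<in> borel_measurable \<mu>"
    using h measurable_cong_sets[OF sets_mu refl] by auto
  have "\<nu> = \<rho>"
  proof (rule measure_eqI)
    show "sets \<nu> = sets \<rho>"
      by (simp add: \<nu>_def \<rho>_def sets_mu)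
    fix A assume "A \<in> sets \<nu>"
    then have A [measurable]: "A \<in> sets borel"
      by (simp add: \<nu>_def)
    then have Amu: "A \<in> sets \<mu>"
      by (simp add: sets_mu)
    let ?m = "measure (density \<mu> (\<lambda>y. ennreal (g x y))) A"
    have "emeasure (density \<mu> (\<lambda>y. ennreal (g x y))) A \<le> (\<integral>\<^sup>+y. ennreal (g x y) \<partial>\<mu>)"
      using gm Amu by (simp add: emeasure_density) (intro nn_integral_mono, auto simp: indicator_def)
    also have "\<dots> = 1"
      using density_g[OF x] by simp
    finally have m: "ennreal ?m = emeasure (density \<mu> (\<lambda>y. ennreal (g x y))) A"
      by (intro emeasure_eq_ennreal_measure[symmetric]) (auto simp: top_unique)
    have ev: "{\<omega> \<in> space M. Y t \<omega> \<in> A} \<in> events"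
      by measurable
    have "emeasure \<nu> A = emeasure (density M V) (Y t -` A \<inter> space M)"
      unfolding \<nu>_def by (subst emeasure_distr) auto
    also have "\<dots> = (\<integral>\<^sup>+\<omega>. V \<omega> * indicator {\<omega> \<in> space M. Y t \<omega> \<in> A} \<omega> \<partial>M)"
      by (subst emeasure_density)
        (auto intro!: nn_integral_cong simp: indicator_def)
    also have "\<dots> = (\<integral>\<^sup>+\<omega>. V \<omega> * ennreal (cprob M (pre_response t) (\<lambda>\<omega>. Y t \<omega> \<in> A) \<omega>) \<partial>M)"
      by (rule nn_integral_cprob[OF subalgebra_pre_response[OF t] ev V, symmetric])
    also have "\<dots> = (\<integral>\<^sup>+\<omega>. V \<omega> * ennreal ?m \<partial>M)"
    proof (rule nn_integral_cong_AE)
      have after: "latent \<Theta> (enat t) \<omega> = 1" if "latent \<Theta> (enat u) \<omega> = 1" for \<omega>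
        using that u by (auto simp: latent_def split: if_splits)
          (meson enat_ord_simps(1) leD leI le_less_trans)
      show "AE \<omega> in M. V \<omega> * ennreal (cprob M (pre_response t) (\<lambda>\<omega>. Y t \<omega> \<in> A) \<omega>) = V \<omega> * ennreal ?m"
        by (rule AE_mp[OF response[OF t A, folded pre_response_def]])
          (auto simp: V_def E_def indicator_def after)
    qed
    also have "\<dots> = (\<integral>\<^sup>+\<omega>. V \<omega> \<partial>M) * ennreal ?m"
      by (rule nn_integral_multc) measurable
    also have "\<dots> = emeasure \<rho> A"
      by (simp add: \<rho>_def m)
    finally show "emeasure \<nu> A = emeasure \<rho> A" .
  qed
  then have "(\<integral>\<^sup>+y. h y \<partial>\<nu>) = (\<integral>\<^sup>+y. h y \<partial>\<rho>)"
    by simp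
  moreover have "(\<integral>\<^sup>+y. h y \<partial>\<nu>) = (\<integral>\<^sup>+\<omega>. V \<omega> * h (Y t \<omega>) \<partial>M)"
    unfolding \<nu>_def using h by (simp add: nn_integral_distr nn_integral_density)
  moreover have "(\<integral>\<^sup>+y. h y \<partial>\<rho>) = (\<integral>\<^sup>+\<omega>. V \<omega> \<partial>M) * (\<integral>\<^sup>+y. h y * ennreal (g x y) \<partial>\<mu>)"
    unfolding \<rho>_def using hmu gm
    by (simp add: nn_integral_scale_measure nn_integral_density mult.commute)
  ultimately show ?thesis
    by (simp add: V_def E_def)
qed

text \<open>After the change \<open>Y\<^sub>t\<close> has density \<open>g\<close>, so the reciprocal likelihood ratio has conditional mean
  \<open>\<integral> (f / g) g d\<mu> \<le> 1\<close>; this makes the reciprocal product a supermartingale.\<close>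

lemma nn_integral_inverse_lik_ratio_le:
  assumes t: "1 \<le> t" and u: "u \<le> t" and Z: "Z \<in> borel_measurable (pre_response t)"
  shows "(\<integral>\<^sup>+\<omega>. Z \<omega> * indicator {\<omega> \<in> space M. latent \<Theta> (enat u) \<omega> = 1} \<omega> *
      inverse (lik_ratio f g X Y t \<omega>) \<partial>M) \<le>
    (\<integral>\<^sup>+\<omega>. Z \<omega> * indicator {\<omega> \<in> space M. latent \<Theta> (enat u) \<omega> = 1} \<omega> \<partial>M)"
proof -
  define E where "E x = {\<omega> \<in> space M. latent \<Theta> (enat u) \<omega> = 1 \<and> X t \<omega> = x}" for x
  define h where "h x y = inverse (ennreal (g x y) / ennreal (f x y))" for x y
  let ?L = "{\<omega> \<in> space M. latent \<Theta> (enat u) \<omega> = 1}"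
  note [measurable] = measurable_X[OF t] measurable_latent measurable_Y[OF t]
  have ZM [measurable]: "Z \<in> borel_measurable M"
    using subalgebra_pre_response[OF t] Z by (rule measurable_from_subalg)
  have E [measurable]: "E x \<in> sets M" for x
    unfolding E_def by measurable
  have h [measurable]: "h x \<in> borel_measurable borel" if "x \<in> {1..K}" for x
  proof -
    note [measurable] = measurable_density[OF that]
    show ?thesis
      unfolding h_def by measurable
  qed
  have split_E: "indicator ?L \<omega> * c \<omega> = (\<Sum>x\<in>{1..K}. indicator (E x) \<omega> * c \<omega>)"
    if "\<omega> \<in> space M" for \<omega> and c :: "'a \<Rightarrow> ennreal"
  proof -
    have "X t \<omega> \<in> {1..K}"
      using measurable_space[OF measurable_X[OF t] that] by simp
    moreover have "indicator (E x) \<omega> * c \<omega> = (if X t \<omega> = x then indicator ?L \<omega> * c \<omega> else 0)" for x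
      using that by (auto simp: E_def indicator_def)
    ultimately show ?thesis
      by simp
  qed
  have "(\<integral>\<^sup>+\<omega>. Z \<omega> * indicator ?L \<omega> * inverse (lik_ratio f g X Y t \<omega>) \<partial>M) =
      (\<integral>\<^sup>+\<omega>. (\<Sum>x\<in>{1..K}. Z \<omega> * indicator (E x) \<omega> * h x (Y t \<omega>)) \<partial>M)"
  proof (rule nn_integral_cong)
    fix \<omega> assume \<omega>: "\<omega> \<in> space M"
    have "Z \<omega> * indicator ?L \<omega> * inverse (lik_ratio f g X Y t \<omega>) =
        Z \<omega> * (\<Sum>x\<in>{1..K}. indicator (E x) \<omega> * h (X t \<omega>) (Y t \<omega>))"
      using split_E[OF \<omega>, of "\<lambda>\<omega>. h (X t \<omega>) (Y t \<omega>)"] by (simp add: lik_ratio_def h_def mult.assoc)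
    also have "\<dots> = (\<Sum>x\<in>{1..K}. Z \<omega> * indicator (E x) \<omega> * h x (Y t \<omega>))"
      unfolding sum_distrib_left by (intro sum.cong) (auto simp: E_def indicator_def)
    finally show "Z \<omega> * indicator ?L \<omega> * inverse (lik_ratio f g X Y t \<omega>) = \<dots>" .
  qed
  also have "\<dots> = (\<Sum>x\<in>{1..K}. \<integral>\<^sup>+\<omega>. Z \<omega> * indicator (E x) \<omega> * h x (Y t \<omega>) \<partial>M)"
    by (rule nn_integral_sum) measurable
  also have "\<dots> \<le> (\<Sum>x\<in>{1..K}. \<integral>\<^sup>+\<omega>. Z \<omega> * indicator (E x) \<omega> \<partial>M)"
  proof (rule sum_mono)
    fix x assume x: "x \<in> {1..K}"
    have "(\<integral>\<^sup>+y. h x y * ennreal (g x y) \<partial>\<mu>) \<le> (\<integral>\<^sup>+y. ennreal (f x y) \<partial>\<mu>)"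
      unfolding h_def using density_f[OF x] density_g[OF x]
      by (intro nn_integral_mono inverse_ratio_times_le) auto
    also have "\<dots> = 1"
      using density_f[OF x] by simp
    finally have "(\<integral>\<^sup>+\<omega>. Z \<omega> * indicator (E x) \<omega> \<partial>M) * (\<integral>\<^sup>+y. h x y * ennreal (g x y) \<partial>\<mu>)
        \<le> (\<integral>\<^sup>+\<omega>. Z \<omega> * indicator (E x) \<omega> \<partial>M) * 1"
      by (rule mult_left_mono) simp
    then show "(\<integral>\<^sup>+\<omega>. Z \<omega> * indicator (E x) \<omega> * h x (Y t \<omega>) \<partial>M) \<le> (\<integral>\<^sup>+\<omega>. Z \<omega> * indicator (E x) \<omega> \<partial>M)"
      using nn_integral_response[OF t u x Z h[OF x]] by (simp add: E_def)
  qed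
  also have "\<dots> = (\<integral>\<^sup>+\<omega>. (\<Sum>x\<in>{1..K}. Z \<omega> * indicator (E x) \<omega>) \<partial>M)"
    by (rule nn_integral_sum[symmetric]) measurable
  also have "\<dots> = (\<integral>\<^sup>+\<omega>. Z \<omega> * indicator ?L \<omega> \<partial>M)"
  proof (rule nn_integral_cong)
    fix \<omega> assume "\<omega> \<in> space M"
    then show "(\<Sum>x\<in>{1..K}. Z \<omega> * indicator (E x) \<omega>) = Z \<omega> * indicator ?L \<omega>"
      using split_E[of \<omega> "\<lambda>_. 1"] by (simp add: sum_distrib_left)
  qed
  finally show ?thesis .
qed

lemma lr_time_bound:
  assumes A: "A \<in> sets (\<F> (enat u))" and d: "1 \<le> d"
  shows "prob {\<omega> \<in> A. lr_time (lik_ratio f g X Y) d (enat u) \<omega> < \<infinity> \<and> latent \<Theta> (enat u) \<omega> = 1} \<le>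
    1 / d * prob {\<omega> \<in> A. latent \<Theta> (enat u) \<omega> = 1}"
proof -
  let ?\<Lambda> = "lik_ratio f g X Y"
  let ?L = "{\<omega> \<in> space M. latent \<Theta> (enat u) \<omega> = 1}"
  define E where "E = {\<omega> \<in> A. latent \<Theta> (enat u) \<omega> = 1}"
  define W where "W s \<omega> = (\<Prod>j=1..s. inverse (?\<Lambda> (u + j) \<omega>))" for s \<omega>
  have W_Suc: "W (Suc s) \<omega> = W s \<omega> * inverse (?\<Lambda> (u + Suc s) \<omega>)" for s \<omega>
    by (simp add: W_def prod.nat_ivl_Suc' mult.commute)
  have sub: "A \<subseteq> space M" "A \<in> events"
    using sets.sets_into_space[OF A] A subalgebra_hist by (auto simp: subalgebra_def filt.space_F)
  have [measurable]: "latent \<Theta> (enat u) \<in> M \<rightarrow>\<^sub>M count_space UNIV"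
    by (rule measurable_latent)
  have E_eq: "E = A \<inter> ?L"
    using sub by (auto simp: E_def)
  have E [measurable]: "E \<in> events"
    unfolding E_eq using sub by measurable
  have \<Lambda>_hist: "?\<Lambda> (u + j) \<in> borel_measurable (\<F> (enat (u + s)))" if "1 \<le> j" "j \<le> s" for j s
    using that by (intro measurable_lik_ratio_hist) auto
  have \<Lambda>_M: "?\<Lambda> (u + j) \<in> borel_measurable M" if "1 \<le> j" for j
    using \<Lambda>_hist[OF that order_refl] subalgebra_hist by (rule measurable_from_subalg[rotated])
  have W_hist: "W i \<in> borel_measurable (\<F> (enat (u + s)))" if "i \<le> s" for i s
    unfolding W_def using that
    by (intro borel_measurable_prod_ennreal borel_measurable_inverse_ennreal \<Lambda>_hist) auto
  have W_M [measurable]: "W s \<in> borel_measurable M" for s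
    using W_hist[OF order_refl] subalgebra_hist by (rule measurable_from_subalg[rotated])
  have step: "(\<integral>\<^sup>+\<omega>. Z \<omega> * indicator ?L \<omega> * inverse (?\<Lambda> (u + Suc s) \<omega>) \<partial>M) \<le>
      (\<integral>\<^sup>+\<omega>. Z \<omega> * indicator ?L \<omega> \<partial>M)" if "Z \<in> borel_measurable (\<F> (enat (u + s)))" for Z s
    using that
    by (intro nn_integral_inverse_lik_ratio_le measurable_hist_pre_response[of "u + s"]) auto
  have A_hist: "A \<in> sets (\<F> (enat (u + s)))" for s
    using A filt.sets_F_mono[of "enat u" "enat (u + s)"] by auto
  have "ennreal d * emeasure M {\<omega> \<in> E. \<exists>i\<ge>1. ennreal d \<le> W i \<omega>} \<le> (\<integral>\<^sup>+\<omega>. indicator E \<omega> * W 0 \<omega> \<partial>M)"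
  proof (rule maximal_inequality)
    fix s
    let ?D = "{\<omega> \<in> A. \<forall>i\<in>{1..s}. W i \<omega> < ennreal d}"
    have D_eq: "?D = A \<inter> {\<omega> \<in> space (\<F> (enat (u + s))). \<forall>i\<in>{1..s}. W i \<omega> < ennreal d}"
      using sub by (auto simp: filt.space_F)
    have "{\<omega> \<in> space (\<F> (enat (u + s))). W i \<omega> < ennreal d} \<in> sets (\<F> (enat (u + s)))"
      if "i \<in> {1..s}" for i
    proof -
      have [measurable]: "W i \<in> borel_measurable (\<F> (enat (u + s)))"
        using that by (intro W_hist) simp
      show ?thesis
        by measurable
    qed
    then have "{\<omega> \<in> space (\<F> (enat (u + s))). \<forall>i\<in>{1..s}. W i \<omega> < ennreal d} \<in> sets (\<F> (enat (u + s)))"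
      by (intro sets.sets_Collect_finite_All) auto
    then have D [measurable]: "?D \<in> sets (\<F> (enat (u + s)))"
      unfolding D_eq using A_hist by (intro sets.Int)
    have ind: "indicator {\<omega> \<in> E. \<forall>i\<in>{1..s}. W i \<omega> < ennreal d} \<omega> = (indicator ?D \<omega> * indicator ?L \<omega> :: ennreal)"
      for \<omega>
      using sub by (auto simp: E_def indicator_def)
    have [measurable]: "W s \<in> borel_measurable (\<F> (enat (u + s)))"
      by (rule W_hist) simp
    have "(\<lambda>\<omega>. indicator ?D \<omega> * W s \<omega>) \<in> borel_measurable (\<F> (enat (u + s)))"
      by measurable
    from step[OF this]
    show "(\<integral>\<^sup>+\<omega>. indicator {\<omega> \<in> E. \<forall>i\<in>{1..s}. W i \<omega> < ennreal d} \<omega> * W (Suc s) \<omega> \<partial>M) \<le>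
        (\<integral>\<^sup>+\<omega>. indicator {\<omega> \<in> E. \<forall>i\<in>{1..s}. W i \<omega> < ennreal d} \<omega> * W s \<omega> \<partial>M)"
      by (simp only: ind W_Suc mult_ac)
  qed measurable
  also have "\<dots> = emeasure M E"
    by (simp add: W_def)
  finally have max: "d * prob {\<omega> \<in> E. \<exists>i\<ge>1. ennreal d \<le> W i \<omega>} \<le> prob E"
    using d by (simp add: emeasure_eq_measure ennreal_mult[symmetric])
  have "AE \<omega> in M. \<omega> \<in> E \<longrightarrow> ?\<Lambda> (u + Suc s) \<omega> \<noteq> 0" for s
  proof -
    have A1: "(indicator A :: 'a \<Rightarrow> ennreal) \<in> borel_measurable (\<F> (enat (u + s)))"
      using A_hist by simp
    have ind: "indicator A \<omega> * indicator ?L \<omega> = (indicator E \<omega> :: ennreal)" for \<omega>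
      by (auto simp: E_eq indicator_def)
    have [measurable]: "?\<Lambda> (u + Suc s) \<in> borel_measurable M"
      by (rule \<Lambda>_M) simp
    have meas: "(\<lambda>\<omega>. indicator E \<omega> * inverse (?\<Lambda> (u + Suc s) \<omega>)) \<in> borel_measurable M"
      by measurable
    have "(\<integral>\<^sup>+\<omega>. indicator E \<omega> * inverse (?\<Lambda> (u + Suc s) \<omega>) \<partial>M) \<le> (\<integral>\<^sup>+\<omega>. indicator E \<omega> \<partial>M)"
      using step[OF A1] by (simp only: ind)
    also have "\<dots> < \<infinity>"
      by (simp add: emeasure_eq_measure)
    finally have "AE \<omega> in M. indicator E \<omega> * inverse (?\<Lambda> (u + Suc s) \<omega>) \<noteq> \<infinity>"
      by (intro nn_integral_PInf_AE[OF meas]) simp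
    then show ?thesis
      by eventually_elim auto
  qed
  then have pos: "AE \<omega> in M. \<forall>s. \<omega> \<in> E \<longrightarrow> ?\<Lambda> (u + Suc s) \<omega> \<noteq> 0"
    unfolding AE_all_countable by blast
  have "prob {\<omega> \<in> A. lr_time ?\<Lambda> d (enat u) \<omega> < \<infinity> \<and> latent \<Theta> (enat u) \<omega> = 1} \<le>
      prob {\<omega> \<in> E. \<exists>i\<ge>1. ennreal d \<le> W i \<omega>}"
  proof (rule finite_measure_mono_AE)
    have "{\<omega> \<in> E. \<exists>i\<ge>1. ennreal d \<le> W i \<omega>} = E \<inter> {\<omega> \<in> space M. \<exists>i\<ge>1. ennreal d \<le> W i \<omega>}"
      using sub by (auto simp: E_def)
    then show "{\<omega> \<in> E. \<exists>i\<ge>1. ennreal d \<le> W i \<omega>} \<in> events"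
      by simp
    show "AE \<omega> in M. \<omega> \<in> {\<omega> \<in> A. lr_time ?\<Lambda> d (enat u) \<omega> < \<infinity> \<and> latent \<Theta> (enat u) \<omega> = 1} \<longrightarrow>
        \<omega> \<in> {\<omega> \<in> E. \<exists>i\<ge>1. ennreal d \<le> W i \<omega>}"
      using pos
    proof (eventually_elim, intro impI)
      fix \<omega> assume pos: "\<forall>s. \<omega> \<in> E \<longrightarrow> ?\<Lambda> (u + Suc s) \<omega> \<noteq> 0"
        and "\<omega> \<in> {\<omega> \<in> A. lr_time ?\<Lambda> d (enat u) \<omega> < \<infinity> \<and> latent \<Theta> (enat u) \<omega> = 1}"
      then have \<omega>: "\<omega> \<in> E" and "lr_time ?\<Lambda> d (enat u) \<omega> < \<infinity>"
        by (auto simp: E_def)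
      then obtain k where "lr_time ?\<Lambda> d (enat u) \<omega> = enat k"
        by (auto elim!: less_infinityE)
      then have "lr_time ?\<Lambda> d (enat u) \<omega> \<le> enat k"
        by simp
      then obtain s where s: "1 \<le> s" "(\<Prod>j=1..s. ?\<Lambda> (u + j) \<omega>) \<le> ennreal (1 / d)"
        unfolding lr_time_le_iff by blast
      have nz: "?\<Lambda> (u + j) \<omega> \<noteq> 0" if "j \<in> {1..s}" for j
        using pos \<omega> that by (cases j) auto
      have "ennreal d = inverse (ennreal (1 / d))"
        using d by (simp add: inverse_ennreal)
      also have "\<dots> \<le> inverse (\<Prod>j=1..s. ?\<Lambda> (u + j) \<omega>)"
        using s(2) by (rule inverse_antimono_ennreal)
      also have "\<dots> = W s \<omega>"
        unfolding W_def using nz by (rule inverse_prod_ennreal)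
      finally show "\<omega> \<in> {\<omega> \<in> E. \<exists>i\<ge>1. ennreal d \<le> W i \<omega>}"
        using \<omega> s(1) by blast
    qed
  qed
  then show ?thesis
    using max d by (simp add: E_def field_simps) (smt (verit) mult_left_mono)
qed

section \<open>The stages as stopping times\<close>

lemma pred_odds_time:
  assumes \<Gamma>: "\<And>t. \<Gamma> t \<in> borel_measurable (\<F> (enat t))" and "u + k \<le> t"
  shows "Measurable.pred (\<F> (enat t)) (\<lambda>\<omega>. odds_time \<Gamma> b (enat u) \<omega> \<le> enat k)"
  unfolding odds_time_le_iff
proof (intro pred_intros_finite)
  fix s assume "s \<in> {..k}"
  then have "sets (\<F> (enat (u + s))) \<subseteq> sets (\<F> (enat t))"
    using assms(2) by (intro filt.sets_F_mono) simp
  then have [measurable]: "\<Gamma> (u + s) \<in> borel_measurable (\<F> (enat t))"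
    by (intro measurable_from_subalg[OF _ \<Gamma>]) (simp add: subalgebra_def filt.space_F)
  show "Measurable.pred (\<F> (enat t)) (\<lambda>\<omega>. ennreal b \<le> \<Gamma> (u + s) \<omega>)"
    by measurable
qed simp

lemma pred_lr_time:
  assumes "u + k \<le> t"
  shows "Measurable.pred (\<F> (enat t)) (\<lambda>\<omega>. lr_time (lik_ratio f g X Y) d (enat u) \<omega> \<le> enat k)"
  unfolding lr_time_le_iff
proof (intro pred_intros_finite)
  fix s assume "s \<in> {..k}"
  then have [measurable]: "(\<lambda>\<omega>. \<Prod>j=1..s. lik_ratio f g X Y (u + j) \<omega>) \<in> borel_measurable (\<F> (enat t))"
    using assms by (intro borel_measurable_prod_ennreal measurable_lik_ratio_hist) auto
  show "Measurable.pred (\<F> (enat t))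
      (\<lambda>\<omega>. 1 \<le> s \<and> (\<Prod>j=1..s. lik_ratio f g X Y (u + j) \<omega>) \<le> ennreal (1 / d))"
    by measurable
qed simp

lemma measurable_odds_time:
  assumes "\<And>t. \<Gamma> t \<in> borel_measurable (\<F> (enat t))"
  shows "odds_time \<Gamma> b t \<in> M \<rightarrow>\<^sub>M count_space UNIV"
proof (cases t)
  case (enat u)
  show ?thesis
    unfolding enat
    by (intro measurable_enat_le measurable_from_subalg[OF subalgebra_hist pred_odds_time[OF assms order_refl]])
next
  case infinity
  then have "odds_time \<Gamma> b t = (\<lambda>_. \<infinity>)"
    by (auto simp: odds_time_def)
  then show ?thesis
    by simp
qed

lemma measurable_lr_time: "lr_time (lik_ratio f g X Y) d t \<in> M \<rightarrow>\<^sub>M count_space UNIV"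
proof (cases t)
  case (enat u)
  show ?thesis
    unfolding enat
    by (intro measurable_enat_le measurable_from_subalg[OF subalgebra_hist pred_lr_time[OF order_refl]])
next
  case infinity
  then have "lr_time (lik_ratio f g X Y) d t = (\<lambda>_. \<infinity>)"
    by (auto simp: lr_time_def)
  then show ?thesis
    by simp
qed

lemma stopping_time_stage:
  assumes \<Gamma>: "\<And>t. \<Gamma> t \<in> borel_measurable (\<F> (enat t))"
  shows "stopping_time \<F> (stage \<Gamma> (lik_ratio f g X Y) b\<^sub>1 b\<^sub>2 d n)"
proof (induction n)
  case (Suc n)
  let ?\<Lambda> = "lik_ratio f g X Y"
  let ?S = "stage \<Gamma> ?\<Lambda> b\<^sub>1 b\<^sub>2 d n"
  define R where "R s \<omega> = (if even n then odds_time \<Gamma> b\<^sub>1 s \<omega>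
    else min (odds_time \<Gamma> b\<^sub>2 s \<omega>) (lr_time ?\<Lambda> d s \<omega>))" for s \<omega>
  have stage_Suc: "stage \<Gamma> ?\<Lambda> b\<^sub>1 b\<^sub>2 d (Suc n) \<omega> = ?S \<omega> + R (?S \<omega>) \<omega>" for \<omega>
    by (simp add: R_def Let_def)
  have R: "Measurable.pred (\<F> (enat t)) (\<lambda>\<omega>. R (enat u) \<omega> \<le> enat k)" if "u + k \<le> t" for u k t
    using pred_odds_time[OF \<Gamma> that] pred_lr_time[OF that] unfolding R_def by (auto simp: min_le_iff_disj)
  show ?case
  proof (rule stopping_timeI)
    fix t
    show "Measurable.pred (\<F> t) (\<lambda>\<omega>. stage \<Gamma> ?\<Lambda> b\<^sub>1 b\<^sub>2 d (Suc n) \<omega> \<le> t)"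
    proof (cases t)
      case (enat k)
      have sum_le: "a + b \<le> enat k \<longleftrightarrow> (\<exists>u\<le>k. a = enat u \<and> b \<le> enat (k - u))" for a b
        by (cases a; cases b) auto
      have "Measurable.pred (\<F> t) (\<lambda>\<omega>. \<exists>u\<in>{..k}. ?S \<omega> = enat u \<and> R (enat u) \<omega> \<le> enat (k - u))"
      proof (intro pred_intros_finite pred_intros_logic)
        fix u assume "u \<in> {..k}"
        then have "enat u \<le> t" "u + (k - u) \<le> k"
          by (auto simp: enat)
        then show "Measurable.pred (\<F> t) (\<lambda>\<omega>. ?S \<omega> = enat u)"
          "Measurable.pred (\<F> t) (\<lambda>\<omega>. R (enat u) \<omega> \<le> enat (k - u))"
          using filt.stopping_time_eq_const[OF Suc, of "enat u"] filt.sets_F_mono[of "enat u" t] R[of u "k - u" k]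
          by (auto simp: pred_def filt.space_F enat)
      qed simp
      moreover have "stage \<Gamma> ?\<Lambda> b\<^sub>1 b\<^sub>2 d (Suc n) \<omega> \<le> t \<longleftrightarrow>
          (\<exists>u\<in>{..k}. ?S \<omega> = enat u \<and> R (enat u) \<omega> \<le> enat (k - u))" for \<omega>
        unfolding stage_Suc enat sum_le by auto
      ultimately show ?thesis
        by simp
    qed simp
  qed
qed (simp add: stopping_time_const)

lemma odds_bound:
  assumes \<Gamma>: "posterior_odds M K \<Theta> X Y \<Gamma>" and A: "A \<in> sets (\<F> (enat u))"
    and b: "0 \<le> b" "\<And>\<omega>. \<omega> \<in> A \<Longrightarrow> ennreal b \<le> \<Gamma> u \<omega>"
  shows "prob {\<omega> \<in> A. latent \<Theta> (enat u) \<omega> = 0} \<le> 1 / (1 + b) * prob A"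
proof -
  let ?P = "\<lambda>i. cprob M (\<F> (enat u)) (\<lambda>\<omega>. latent \<Theta> (enat u) \<omega> = i)"
  let ?p = "\<lambda>i. prob {\<omega> \<in> A. latent \<Theta> (enat u) \<omega> = i}"
  note [measurable] = measurable_latent
  have ev: "{\<omega> \<in> space M. latent \<Theta> (enat u) \<omega> = i} \<in> events" for i
    by measurable
  have AM: "A \<in> events" "A \<subseteq> space M"
    using sets.sets_into_space[OF A] A subalgebra_hist by (auto simp: subalgebra_def filt.space_F)
  note int = set_integral_cprob[OF subalgebra_hist ev A]
  have "AE \<omega> in M. \<Gamma> u \<omega> = ennreal (?P 1 \<omega>) / ennreal (?P 0 \<omega>)"
    using \<Gamma> by (simp add: posterior_odds_def)
  then have "AE \<omega> in M. \<omega> \<in> A \<longrightarrow> b * ?P 0 \<omega> \<le> ?P 1 \<omega>"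
    using AE_cprob_nonneg[OF subalgebra_hist ev, of "enat u" 0] AE_cprob_nonneg[OF subalgebra_hist ev, of "enat u" 1]
  proof eventually_elim
    case (elim \<omega>)
    show ?case
    proof
      assume "\<omega> \<in> A"
      then have "ennreal b \<le> ennreal (?P 1 \<omega>) / ennreal (?P 0 \<omega>)"
        using b(2) elim(1) by metis
      then show "b * ?P 0 \<omega> \<le> ?P 1 \<omega>"
        using elim b(1) by (intro le_divide_ennreal_imp_mult_le)
    qed
  qed
  then have "(LINT \<omega>:A|M. b * ?P 0 \<omega>) \<le> (LINT \<omega>:A|M. ?P 1 \<omega>)"
    using int by (intro set_integral_mono_AE set_integrable_mult_right) auto
  then have "b * ?p 0 \<le> ?p 1"
    using int by simp
  moreover have "prob A = ?p 0 + ?p 1"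
  proof -
    have eq: "{\<omega> \<in> A. latent \<Theta> (enat u) \<omega> = i} = A \<inter> {\<omega> \<in> space M. latent \<Theta> (enat u) \<omega> = i}" for i
      using AM by auto
    have "A = {\<omega> \<in> A. latent \<Theta> (enat u) \<omega> = 0} \<union> {\<omega> \<in> A. latent \<Theta> (enat u) \<omega> = 1}"
      by (auto simp: latent_def)
    moreover have "{\<omega> \<in> A. latent \<Theta> (enat u) \<omega> = i} \<in> events" for i
      unfolding eq using AM ev by blast
    ultimately show ?thesis
      by (subst finite_measure_Union[symmetric]) auto
  qed
  ultimately show ?thesis
    using b by (simp add: field_simps)
qed

lemma stopped_hist_facts:
  assumes T: "stopping_time \<F> T"
  shows subalgebra_stopped_hist: "subalgebra M (stopped_hist M K X Y T)"
    and stopped_hist_at: "{\<omega> \<in> space M. T \<omega> = t} \<in> sets (stopped_hist M K X Y T)"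
    and sets_stopped_hist_at: "\<And>A. A \<in> sets (stopped_hist M K X Y T) \<Longrightarrow>
      A \<subseteq> {\<omega> \<in> space M. T \<omega> = t} \<Longrightarrow> A \<in> sets (\<F> t)"
proof -
  have D: "{\<omega> \<in> A. T \<omega> \<le> s} \<in> sets (\<F> s)" if "A \<in> sets (stopped_hist M K X Y T)" for A s
    using filt.sets_pre_sigmaD[OF T] that unfolding stopped_hist_def by blast
  show "subalgebra M (stopped_hist M K X Y T)"
    unfolding subalgebra_def
  proof
    show "space (stopped_hist M K X Y T) = space M"
      unfolding stopped_hist_def by (rule filt.space_pre_sigma)
    show "sets (stopped_hist M K X Y T) \<subseteq> sets M"
    proof
      fix A assume "A \<in> sets (stopped_hist M K X Y T)"
      from D[OF this, of \<infinity>] show "A \<in> sets M"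
        using subalgebra_hist[of \<infinity>] by (auto simp: subalgebra_def)
    qed
  qed
  have "T -` {t} \<inter> space (filt.pre_sigma T) \<in> sets (filt.pre_sigma T)"
    by (rule measurable_sets[OF filt.measurable_stopping_time_pre_sigma[OF T]]) simp
  moreover have "T -` {t} \<inter> space (filt.pre_sigma T) = {\<omega> \<in> space M. T \<omega> = t}"
    by (auto simp: filt.space_pre_sigma)
  ultimately show "{\<omega> \<in> space M. T \<omega> = t} \<in> sets (stopped_hist M K X Y T)"
    by (simp add: stopped_hist_def)
  show "A \<in> sets (\<F> t)" if "A \<in> sets (stopped_hist M K X Y T)" "A \<subseteq> {\<omega> \<in> space M. T \<omega> = t}" for A
  proof -
    have "{\<omega> \<in> A. T \<omega> \<le> t} = A"
      using that by auto
    then show ?thesis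
      using D[OF that(1), of t] by simp
  qed
qed

lemma AE_cprob_stopped_hist_le:
  assumes T: "stopping_time \<F> T"
    and P: "{\<omega> \<in> space M. P (T \<omega>) \<omega>} \<in> events" and Q: "{\<omega> \<in> space M. Q (T \<omega>) \<omega>} \<in> events"
    and le: "\<And>A u. A \<in> sets (\<F> (enat u)) \<Longrightarrow> A \<subseteq> {\<omega> \<in> space M. T \<omega> = enat u} \<Longrightarrow>
      prob {\<omega> \<in> A. P (enat u) \<omega>} \<le> c * prob {\<omega> \<in> A. Q (enat u) \<omega>}"
  shows "AE \<omega> in M. T \<omega> < \<infinity> \<longrightarrow> cprob M (stopped_hist M K X Y T) (\<lambda>\<omega>. P (T \<omega>) \<omega>) \<omega> \<le>
    c * cprob M (stopped_hist M K X Y T) (\<lambda>\<omega>. Q (T \<omega>) \<omega>) \<omega>"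
proof -
  have "AE \<omega> in M. \<omega> \<in> {\<omega> \<in> space M. T \<omega> = enat u} \<longrightarrow>
      cprob M (stopped_hist M K X Y T) (\<lambda>\<omega>. P (T \<omega>) \<omega>) \<omega> \<le>
      c * cprob M (stopped_hist M K X Y T) (\<lambda>\<omega>. Q (T \<omega>) \<omega>) \<omega>" for u
  proof (rule AE_cprob_le[OF subalgebra_stopped_hist[OF T] P Q stopped_hist_at[OF T]])
    fix A assume A: "A \<in> sets (stopped_hist M K X Y T)" "A \<subseteq> {\<omega> \<in> space M. T \<omega> = enat u}"
    have "{\<omega> \<in> A. R (T \<omega>) \<omega>} = {\<omega> \<in> A. R (enat u) \<omega>}" for R :: "enat \<Rightarrow> 'a \<Rightarrow> bool"
      using A(2) by auto
    then show "prob {\<omega> \<in> A. P (T \<omega>) \<omega>} \<le> c * prob {\<omega> \<in> A. Q (T \<omega>) \<omega>}"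
      using le[OF sets_stopped_hist_at[OF T A] A(2)] by simp
  qed
  then have "AE \<omega> in M. \<forall>u. \<omega> \<in> {\<omega> \<in> space M. T \<omega> = enat u} \<longrightarrow>
      cprob M (stopped_hist M K X Y T) (\<lambda>\<omega>. P (T \<omega>) \<omega>) \<omega> \<le>
      c * cprob M (stopped_hist M K X Y T) (\<lambda>\<omega>. Q (T \<omega>) \<omega>) \<omega>"
    unfolding AE_all_countable by blast
  then show ?thesis
    using AE_space by eventually_elim (auto elim!: less_infinityE)
qed

end

theorem lemmaC1:
  fixes M :: "'a measure"
    and K :: nat
    and \<mu> :: "'y::polish_space measure"
    and f g :: "nat \<Rightarrow> 'y \<Rightarrow> real"
    and \<pi> :: "nat list \<Rightarrow> real"
    and \<Theta> :: "'a \<Rightarrow> enat"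
    and X :: "nat \<Rightarrow> 'a \<Rightarrow> nat"
    and Y :: "nat \<Rightarrow> 'a \<Rightarrow> 'y"
    and \<Gamma> \<Lambda> :: "nat \<Rightarrow> 'a \<Rightarrow> ennreal"
    and \<Xi>\<^sub>1 \<Xi>\<^sub>2 :: "nat list"
    and b\<^sub>1 b\<^sub>2 d :: real
    and S :: "nat \<Rightarrow> 'a \<Rightarrow> enat"
    and T :: "'a \<Rightarrow> enat"
    and n :: nat
  assumes "changepoint_model M K \<mu> f g \<pi> \<Theta> X Y"
    and "posterior_odds M K \<Theta> X Y \<Gamma>"
    and "\<Lambda> = lik_ratio f g X Y"
    and "block K \<Xi>\<^sub>1" and "block K \<Xi>\<^sub>2"
    and "1 \<le> b\<^sub>1" and "b\<^sub>1 \<le> b\<^sub>2" and "1 \<le> d"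
    and "S = stage \<Gamma> \<Lambda> b\<^sub>1 b\<^sub>2 d"
    and "T = stop_time \<Gamma> \<Lambda> b\<^sub>1 b\<^sub>2 d"
    and "proposed_treatments M \<Xi>\<^sub>1 \<Xi>\<^sub>2 \<Gamma> \<Lambda> b\<^sub>1 b\<^sub>2 d X"
    and "odd n"
  shows "AE \<omega> in M. S n \<omega> < T \<omega> \<longrightarrow>
      cprob M (stopped_hist M K X Y (S n)) (\<lambda>\<omega>. latent \<Theta> (S n \<omega>) \<omega> = 0) \<omega> \<le> 1 / (1 + b\<^sub>1) \<and>
      cprob M (stopped_hist M K X Y (S n))
        (\<lambda>\<omega>. lr_time \<Lambda> d (S n \<omega>) \<omega> < odds_time \<Gamma> b\<^sub>2 (S n \<omega>) \<omega> \<and> latent \<Theta> (S n \<omega>) \<omega> = 1) \<omega>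
      \<le> 1 / d * cprob M (stopped_hist M K X Y (S n)) (\<lambda>\<omega>. latent \<Theta> (S n \<omega>) \<omega> = 1) \<omega>"
proof -
  interpret changepoint_model M K \<mu> f g \<pi> \<Theta> X Y
    by fact
  let ?G = "stopped_hist M K X Y (S n)"
  have \<Gamma>: "\<Gamma> t \<in> borel_measurable (hist M K X Y (enat t))" for t
    using \<open>posterior_odds M K \<Theta> X Y \<Gamma>\<close> by (simp add: posterior_odds_def)
  have T: "stopping_time (hist M K X Y) (S n)"
    unfolding \<open>S = _\<close> \<open>\<Lambda> = _\<close> using \<Gamma> by (rule stopping_time_stage)
  have S [measurable]: "S n \<in> M \<rightarrow>\<^sub>M count_space UNIV"
    by (rule measurable_enat_le, rule measurable_from_subalg[OF subalgebra_hist stopping_timeD[OF T]])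
  have at_S: "(\<lambda>\<omega>. R (S n \<omega>) \<omega>) \<in> M \<rightarrow>\<^sub>M N" if "\<And>t. R t \<in> M \<rightarrow>\<^sub>M count_space UNIV" "space N = UNIV"
    for R :: "enat \<Rightarrow> 'a \<Rightarrow> 'c" and N
    by (rule measurable_compose[OF measurable_compose_countable[OF that(1) S]]) (simp add: that(2))
  have L: "{\<omega> \<in> space M. latent \<Theta> (S n \<omega>) \<omega> = i} \<in> events" for i
  proof -
    have [measurable]: "(\<lambda>\<omega>. latent \<Theta> (S n \<omega>) \<omega>) \<in> M \<rightarrow>\<^sub>M count_space UNIV"
      by (rule at_S[OF measurable_latent]) simp
    show ?thesis
      by measurable
  qed
  have "{\<omega> \<in> space M. lr_time \<Lambda> d (S n \<omega>) \<omega> < odds_time \<Gamma> b\<^sub>2 (S n \<omega>) \<omega>} \<in> events"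
  proof (rule borel_measurable_less)
    show "(\<lambda>\<omega>. lr_time \<Lambda> d (S n \<omega>) \<omega>) \<in> borel_measurable M"
      unfolding \<open>\<Lambda> = _\<close> by (rule at_S[OF measurable_lr_time]) simp
    show "(\<lambda>\<omega>. odds_time \<Gamma> b\<^sub>2 (S n \<omega>) \<omega>) \<in> borel_measurable M"
      by (rule at_S[OF measurable_odds_time[OF \<Gamma>]]) simp
  qed
  from L this have B: "{\<omega> \<in> space M. lr_time \<Lambda> d (S n \<omega>) \<omega> < odds_time \<Gamma> b\<^sub>2 (S n \<omega>) \<omega> \<and> latent \<Theta> (S n \<omega>) \<omega> = 1} \<in> events"
    by (rule sets.sets_Collect_conj)
  have "AE \<omega> in M. S n \<omega> < \<infinity> \<longrightarrow> cprob M ?G (\<lambda>\<omega>. latent \<Theta> (S n \<omega>) \<omega> = 0) \<omega> \<le>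
      1 / (1 + b\<^sub>1) * cprob M ?G (\<lambda>\<omega>. True) \<omega>"
  proof (rule AE_cprob_stopped_hist_le[OF T, where P = "\<lambda>t \<omega>. latent \<Theta> t \<omega> = 0" and Q = "\<lambda>_ _. True"])
    fix A u assume A: "A \<in> sets (hist M K X Y (enat u))" "A \<subseteq> {\<omega> \<in> space M. S n \<omega> = enat u}"
    then have "ennreal b\<^sub>1 \<le> \<Gamma> u \<omega>" if "\<omega> \<in> A" for \<omega>
      using that \<open>odd n\<close> \<open>S = _\<close> by (blast intro: stage_odd_odds)
    with A(1) show "prob {\<omega> \<in> A. latent \<Theta> (enat u) \<omega> = 0} \<le> 1 / (1 + b\<^sub>1) * prob {\<omega> \<in> A. True}"
      using odds_bound[OF \<open>posterior_odds M K \<Theta> X Y \<Gamma>\<close>, of A u b\<^sub>1] \<open>1 \<le> b\<^sub>1\<close> by simp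
  qed (simp_all add: L)
  moreover have "AE \<omega> in M. S n \<omega> < \<infinity> \<longrightarrow>
      cprob M ?G (\<lambda>\<omega>. lr_time \<Lambda> d (S n \<omega>) \<omega> < odds_time \<Gamma> b\<^sub>2 (S n \<omega>) \<omega> \<and> latent \<Theta> (S n \<omega>) \<omega> = 1) \<omega>
      \<le> 1 / d * cprob M ?G (\<lambda>\<omega>. latent \<Theta> (S n \<omega>) \<omega> = 1) \<omega>"
  proof (rule AE_cprob_stopped_hist_le[OF T, where Q = "\<lambda>t \<omega>. latent \<Theta> t \<omega> = 1"
        and P = "\<lambda>t \<omega>. lr_time \<Lambda> d t \<omega> < odds_time \<Gamma> b\<^sub>2 t \<omega> \<and> latent \<Theta> t \<omega> = 1", OF B L])
    fix A u assume A: "A \<in> sets (hist M K X Y (enat u))"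
    then have AM: "A \<in> events" "A \<subseteq> space M"
      using sets.sets_into_space[of A M] subalgebra_hist by (auto simp: subalgebra_def)
    note [measurable] = measurable_latent measurable_lr_time
    have "{\<omega> \<in> A. lr_time (lik_ratio f g X Y) d (enat u) \<omega> < \<infinity> \<and> latent \<Theta> (enat u) \<omega> = 1} =
        A \<inter> {\<omega> \<in> space M. lr_time (lik_ratio f g X Y) d (enat u) \<omega> < \<infinity> \<and> latent \<Theta> (enat u) \<omega> = 1}"
      using AM by auto
    also have "\<dots> \<in> events"
      using AM(1) by measurable
    finally have "prob {\<omega> \<in> A. lr_time \<Lambda> d (enat u) \<omega> < odds_time \<Gamma> b\<^sub>2 (enat u) \<omega> \<and> latent \<Theta> (enat u) \<omega> = 1} \<le>
        prob {\<omega> \<in> A. lr_time (lik_ratio f g X Y) d (enat u) \<omega> < \<infinity> \<and> latent \<Theta> (enat u) \<omega> = 1}"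
      unfolding \<open>\<Lambda> = _\<close> by (intro finite_measure_mono) (auto dest: less_le_trans[OF _ enat_ord_simps(3)])
    also have "\<dots> \<le> 1 / d * prob {\<omega> \<in> A. latent \<Theta> (enat u) \<omega> = 1}"
      using A \<open>1 \<le> d\<close> by (rule lr_time_bound)
    finally show "prob {\<omega> \<in> A. lr_time \<Lambda> d (enat u) \<omega> < odds_time \<Gamma> b\<^sub>2 (enat u) \<omega> \<and> latent \<Theta> (enat u) \<omega> = 1} \<le>
        1 / d * prob {\<omega> \<in> A. latent \<Theta> (enat u) \<omega> = 1}" .
  qed
  moreover have "AE \<omega> in M. cprob M ?G (\<lambda>\<omega>. True) \<omega> = 1"
  proof -
    interpret finite_measure_subalgebra M ?G
      by standard (rule subalgebra_stopped_hist[OF T])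
    have "space M = space ?G"
      using subalg by (simp add: subalgebra_def)
    then have "space M \<in> sets ?G"
      using sets.top[of ?G] by simp
    then have "AE \<omega> in M. real_cond_exp M ?G (indicat_real (space M)) \<omega> = indicat_real (space M) \<omega>"
      by (intro real_cond_exp_F_meas borel_measurable_indicator) (simp_all add: emeasure_eq_measure)
    then show ?thesis
      using AE_space by eventually_elim (simp add: cprob_def)
  qed
  ultimately show ?thesis
    by eventually_elim (auto dest: less_le_trans[OF _ enat_ord_simps(3)])
qed

end
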